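(* Let $P$ be the Petersen graph, $Cl$ the Clebsch graph, $Gr$ the Grötzsch graph, $D$ the graph of the dodecahedron and $C_5$ the circuit of length $5$. Then $$P\approx_{cc}Cl\approx_{cc}Gr\approx_{cc}D\approx_{cc}C_5 .$$ On the other hand, no two of these five graphs are homomorphically equivalent (for no two distinct graphs $A,B$ among them do homomorphisms $A\to B$ and $B\to A$ both exist).
   Context: All graphs are undirected. The Clebsch graph is the triangle-free $5$-regular graph on $16$ vertices (the folded $5$-cube); the Grötzsch graph is the triangle-free $4$-chromatic graph on $11$ vertices (the Mycielskian of $C_5$); $D$ is the $20$-vertex cubic skeleton of the dodecahedron. A cut in a graph $G=(V,E)$ is the set of all edges with one end in $X$ and the other in $V\setminus X$, for some $X\subseteq V$ (so the empty set is a cut). A mapping $f:E(G)\to E(H)$ is cut-continuous (equivalently $\mathbb Z_2$-tension-continuous) if for every cut $C$ of $H$ the preimage $f^{-1}(C)$ is a cut of $G$. $G\approx_{cc}H$ means that there are cut-continuous mappings $E(G)\to E(H)$ and $E(H)\to E(G)$. *)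

theory Defs
  imports Main
begin

text \<open>
  Simple undirected graphs. Edges are unordered pairs of vertices, since the edge maps below act on
  undirected edges.
\<close>

record 'a ugraph =
  verts :: "'a set"
  edges :: "'a set set"

definition simple_graph :: "'a ugraph \<Rightarrow> bool" where
  "simple_graph G \<longleftrightarrow> finite (verts G) \<and> (\<forall>e\<in>edges G. e \<subseteq> verts G \<and> card e = 2)"

definition cut_of :: "'a ugraph \<Rightarrow> 'a set \<Rightarrow> 'a set set" where
  "cut_of G X = {e \<in> edges G. \<exists>u\<in>X. \<exists>v\<in>verts G - X. e = {u, v}}"

definition is_cut :: "'a ugraph \<Rightarrow> 'a set set \<Rightarrow> bool" where
  "is_cut G C \<longleftrightarrow> (\<exists>X\<subseteq>verts G. C = cut_of G X)"

text \<open>Edge maps are total functions in HOL; only their values on \<open>edges G\<close> matter.\<close>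

definition cut_continuous :: "'a ugraph \<Rightarrow> 'b ugraph \<Rightarrow> ('a set \<Rightarrow> 'b set) \<Rightarrow> bool" where
  "cut_continuous G H f \<longleftrightarrow>
     f ` edges G \<subseteq> edges H \<and> (\<forall>C. is_cut H C \<longrightarrow> is_cut G {e \<in> edges G. f e \<in> C})"

definition cc_equiv :: "'a ugraph \<Rightarrow> 'b ugraph \<Rightarrow> bool"  (infix \<open>\<approx>\<^sub>c\<^sub>c\<close> 50) where
  "G \<approx>\<^sub>c\<^sub>c H \<longleftrightarrow> (\<exists>f. cut_continuous G H f) \<and> (\<exists>g. cut_continuous H G g)"

definition graph_hom :: "'a ugraph \<Rightarrow> 'b ugraph \<Rightarrow> ('a \<Rightarrow> 'b) \<Rightarrow> bool" where
  "graph_hom G H \<phi> \<longleftrightarrow>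
     \<phi> ` verts G \<subseteq> verts H \<and> (\<forall>u v. {u, v} \<in> edges G \<longrightarrow> {\<phi> u, \<phi> v} \<in> edges H)"

definition hom_equiv :: "'a ugraph \<Rightarrow> 'b ugraph \<Rightarrow> bool" where
  "hom_equiv G H \<longleftrightarrow> (\<exists>\<phi>. graph_hom G H \<phi>) \<and> (\<exists>\<psi>. graph_hom H G \<psi>)"

definition cycle_graph :: "nat \<Rightarrow> nat ugraph" where
  "cycle_graph n = \<lparr>verts = {..<n}, edges = {{i, Suc i mod n} | i. i < n}\<rparr>"

text \<open>The Petersen graph as the Kneser graph of the 2-subsets of a 5-set.\<close>

definition petersen :: "nat set ugraph" where
  "petersen =
    \<lparr>verts = {A. A \<subseteq> {..<5} \<and> card A = 2},
     edges = {{A, B} | A B. A \<subseteq> {..<5} \<and> card A = 2 \<and> B \<subseteq> {..<5} \<and> card B = 2 \<and> A \<inter> B = {}}\<rparr>"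

text \<open>
  The folded 5-cube: vertices of the 5-cube are the subsets of \<open>{..<5}\<close>, and each one is identified
  with its antipode, which is its complement.
\<close>

definition antipodal_class :: "nat set \<Rightarrow> nat set set" where
  "antipodal_class A = {A, {..<5} - A}"

definition clebsch :: "nat set set ugraph" where
  "clebsch =
    \<lparr>verts = antipodal_class ` Pow {..<5},
     edges = {{antipodal_class A, antipodal_class B} | A B.
                A \<subseteq> {..<5} \<and> B \<subseteq> {..<5} \<and> card ((A - B) \<union> (B - A)) = 1}\<rparr>"

datatype 'a mycielski = Orig 'a | Copy 'a | Apex

definition mycielskian :: "'a ugraph \<Rightarrow> 'a mycielski ugraph" where
  "mycielskian G =
    \<lparr>verts = Orig ` verts G \<union> Copy ` verts G \<union> {Apex},
     edges = {{Orig u, Orig v} | u v. {u, v} \<in> edges G}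
           \<union> {{Orig u, Copy v} | u v. {u, v} \<in> edges G}
           \<union> {{Copy u, Apex} | u. u \<in> verts G}\<rparr>"

definition groetzsch :: "nat mycielski ugraph" where
  "groetzsch = mycielskian (cycle_graph 5)"

text \<open>
  The twelve faces of the dodecahedron, each listed in cyclic order. Vertices are numbered in four
  horizontal layers of five: 0--4 is the top face, 15--19 the bottom face; vertex \<open>i\<close> of the top
  face hangs on \<open>5 + i\<close>, vertex \<open>15 + i\<close> of the bottom face stands under \<open>10 + i\<close>, and the two
  middle layers form the zigzag 5, 10, 6, 11, 7, 12, 8, 13, 9, 14.
\<close>

definition dodecahedron_faces :: "nat list list" where
  "dodecahedron_faces =
    [[0, 1, 2, 3, 4],
     [0, 1, 6, 10, 5], [1, 2, 7, 11, 6], [2, 3, 8, 12, 7], [3, 4, 9, 13, 8], [4, 0, 5, 14, 9],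
     [10, 6, 11, 16, 15], [11, 7, 12, 17, 16], [12, 8, 13, 18, 17], [13, 9, 14, 19, 18],
     [14, 5, 10, 15, 19],
     [15, 16, 17, 18, 19]]"

definition dodecahedron :: "nat ugraph" where
  "dodecahedron =
    \<lparr>verts = {..<20},
     edges = {{F ! i, F ! (Suc i mod 5)} | F i. F \<in> set dodecahedron_faces \<and> i < 5}\<rparr>"

text \<open>
  Each vertex lies on three of the pentagons and each edge on two of them, so they do form the closed
  surface of the dodecahedron.
\<close>

lemma dodecahedron_edges_explicit:
  "edges dodecahedron =
    {{0, 1}, {1, 2}, {2, 3}, {3, 4}, {4, 0},
     {0, 5}, {1, 6}, {2, 7}, {3, 8}, {4, 9},
     {5, 10}, {10, 6}, {6, 11}, {11, 7}, {7, 12}, {12, 8}, {8, 13}, {13, 9}, {9, 14}, {14, 5},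
     {10, 15}, {11, 16}, {12, 17}, {13, 18}, {14, 19},
     {15, 16}, {16, 17}, {17, 18}, {18, 19}, {19, 15}}"
proof -
  have "edges dodecahedron =
    (\<Union>F\<in>set dodecahedron_faces. (\<lambda>i. {F ! i, F ! (Suc i mod 5)}) ` {0, 1, 2, 3, 4})"
  proof -
    have "{i::nat. i < 5} = {0, 1, 2, 3, 4}" by auto
    moreover have "edges dodecahedron =
      (\<Union>F\<in>set dodecahedron_faces. (\<lambda>i. {F ! i, F ! (Suc i mod 5)}) ` {i. i < 5})"
      unfolding dodecahedron_def ugraph.simps by blast
    ultimately show ?thesis by (simp only:)
  qed
  also have "\<dots> = {{0, 1}, {1, 2}, {2, 3}, {3, 4}, {4, 0},
     {0, 5}, {1, 6}, {2, 7}, {3, 8}, {4, 9},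
     {5, 10}, {10, 6}, {6, 11}, {11, 7}, {7, 12}, {12, 8}, {8, 13}, {13, 9}, {9, 14}, {14, 5},
     {10, 15}, {11, 16}, {12, 17}, {13, 18}, {14, 19},
     {15, 16}, {16, 17}, {17, 18}, {18, 19}, {19, 15}}"
    unfolding dodecahedron_faces_def
    by (rule subset_antisym; simp add: doubleton_eq_iff)
  finally show ?thesis .
qed

lemma dodecahedron_vertex_faces:
  "v \<in> verts dodecahedron \<Longrightarrow> length (filter (\<lambda>F. v \<in> set F) dodecahedron_faces) = 3"
proof -
  have "list_all (\<lambda>v. length (filter (\<lambda>F. v \<in> set F) dodecahedron_faces) = 3) [0..<20]"
    by (simp add: dodecahedron_faces_def upt_rec)
  then show "v \<in> verts dodecahedron \<Longrightarrow> ?thesis"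
    by (simp add: list_all_iff dodecahedron_def)
qed

lemma dodecahedron_edge_faces:
  "e \<in> edges dodecahedron \<Longrightarrow> length (filter (\<lambda>F. e \<subseteq> set F) dodecahedron_faces) = 2"
proof -
  have "\<forall>e\<in>edges dodecahedron. length (filter (\<lambda>F. e \<subseteq> set F) dodecahedron_faces) = 2"
    unfolding dodecahedron_edges_explicit dodecahedron_faces_def by simp
  then show "e \<in> edges dodecahedron \<Longrightarrow> ?thesis" ..
qed

lemma simple_graph_dodecahedron: "simple_graph dodecahedron"
  unfolding simple_graph_def dodecahedron_edges_explicit by (simp add: dodecahedron_def)

lemma simple_graph_cycle_graph: "n \<ge> 3 \<Longrightarrow> simple_graph (cycle_graph n)"
  by (auto simp: simple_graph_def cycle_graph_def mod_Suc card_insert_if)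

lemma simple_graph_mycielskian: "simple_graph G \<Longrightarrow> simple_graph (mycielskian G)"
proof -
  assume G: "simple_graph G"
  have "u \<noteq> v \<and> u \<in> verts G \<and> v \<in> verts G" if "{u, v} \<in> edges G" for u v
    using G that by (force simp: simple_graph_def)
  then show ?thesis
    using G by (auto simp: simple_graph_def mycielskian_def)
qed

lemma simple_graph_groetzsch: "simple_graph groetzsch"
  by (simp add: groetzsch_def simple_graph_mycielskian simple_graph_cycle_graph)

lemma simple_graph_petersen: "simple_graph petersen"
proof -
  have "finite {A. A \<subseteq> {..<5::nat} \<and> card A = 2}" by simp
  moreover have "card {A, B} = 2" if "card A = 2" "A \<inter> B = {}" for A B :: "nat set"
    using that by (cases "A = B") auto
  ultimately show ?thesis by (auto simp: simple_graph_def petersen_def)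
qed

lemma simple_graph_clebsch: "simple_graph clebsch"
proof -
  have "antipodal_class A \<noteq> antipodal_class B"
    if "A \<subseteq> {..<5}" "B \<subseteq> {..<5}" "card ((A - B) \<union> (B - A)) = 1" for A B
  proof
    assume "antipodal_class A = antipodal_class B"
    then have "A = B \<or> A = {..<5} - B"
      unfolding antipodal_class_def doubleton_eq_iff by blast
    moreover have "(A - B) \<union> (B - A) = {..<5}" if "A = {..<5} - B"
      using that \<open>B \<subseteq> {..<5}\<close> by auto
    ultimately have "A = B \<or> card ((A - B) \<union> (B - A)) = 5" by fastforce
    then show False using that(3) by (elim disjE) simp_all
  qed
  then show ?thesis by (auto simp: simple_graph_def clebsch_def card_insert_if)
qed

end

theory Submission
  imports Defs
begin

text \<open>
  All five graphs map homomorphically to the Clebsch graph and receive a homomorphism from the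
  5-circuit, and homomorphisms induce cut-continuous maps. So the first part only needs one map
  that is not induced by a homomorphism: send a Clebsch edge to the edge of the 5-circuit indexed
  by the coordinate which it flips. A cut of the 5-circuit is an even set \<open>S\<close> of edges, and the
  parity of \<open>A \<inter> S\<close> does not change when \<open>A\<close> is complemented, so it defines a cut of the Clebsch
  graph.

  For the second part, a homomorphism to a triangle-free graph separates any two vertices that are
  joined by a walk of length three. In the Petersen, Clebsch and Groetzsch graphs any two distinct
  vertices are so joined, so homomorphisms from them to triangle-free graphs are injective, and
  counting vertices leaves only two cases. An injective image of the Petersen graph in the
  dodecahedron is closed under neighbours, because both graphs are cubic, hence everything. A
  homomorphism from the dodecahedron to the 5-circuit would be injective on the three neighbours of
  a vertex.
\<close>

section \<open>Homomorphisms and cuts\<close>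

lemma simple_graph_edgeE:
  assumes "simple_graph G" "e \<in> edges G"
  obtains u v where "e = {u, v}" "u \<in> verts G" "v \<in> verts G" "u \<noteq> v"
  using assms unfolding simple_graph_def card_2_iff by (metis insert_subset)

lemma edge_in_verts:
  assumes "simple_graph G" "{u, v} \<in> edges G"
  shows "u \<in> verts G" "v \<in> verts G"
  using assms by (auto simp: simple_graph_def)

text \<open>Frees cut membership from the choice of which end lies in \<open>X\<close>.\<close>

lemma edge_in_cut_iff:
  assumes "simple_graph G" "{u, v} \<in> edges G"
  shows "{u, v} \<in> cut_of G X \<longleftrightarrow> (u \<in> X) \<noteq> (v \<in> X)"
  using assms edge_in_verts[OF assms] by (auto simp: cut_of_def doubleton_eq_iff)

text \<open>A cut is represented by a side of it, so that pulling back cuts becomes a pointwise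
  condition on the ends of edges.\<close>

lemma cut_continuousI:
  assumes G: "simple_graph G"
    and edges: "\<And>e. e \<in> edges G \<Longrightarrow> f e \<in> edges H"
    and pull: "\<And>Y. Y \<subseteq> verts H \<Longrightarrow> \<exists>X \<subseteq> verts G. \<forall>u v. {u, v} \<in> edges G \<longrightarrow>
      (f {u, v} \<in> cut_of H Y \<longleftrightarrow> (u \<in> X) \<noteq> (v \<in> X))"
  shows "cut_continuous G H f"
  unfolding cut_continuous_def
proof (intro conjI allI impI)
  show "f ` edges G \<subseteq> edges H" using edges by blast
next
  fix C assume "is_cut H C"
  then obtain Y where Y: "Y \<subseteq> verts H" "C = cut_of H Y" by (auto simp: is_cut_def)
  obtain X where X: "X \<subseteq> verts G"
    "\<And>u v. {u, v} \<in> edges G \<Longrightarrow> f {u, v} \<in> C \<longleftrightarrow> (u \<in> X) \<noteq> (v \<in> X)"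
    using pull[OF Y(1)] Y(2) by blast
  have "e \<in> cut_of G X \<longleftrightarrow> f e \<in> C" if "e \<in> edges G" for e
    using simple_graph_edgeE[OF G that] that by (metis edge_in_cut_iff[OF G] X(2))
  moreover have "cut_of G X \<subseteq> edges G" by (auto simp: cut_of_def)
  ultimately have "{e \<in> edges G. f e \<in> C} = cut_of G X" by blast
  with X(1) show "is_cut G {e \<in> edges G. f e \<in> C}" by (auto simp: is_cut_def)
qed

lemma cut_continuous_comp:
  assumes "cut_continuous G H f" "cut_continuous H K g"
  shows "cut_continuous G K (g \<circ> f)"
  unfolding cut_continuous_def
proof (intro conjI allI impI)
  show "(g \<circ> f) ` edges G \<subseteq> edges K" using assms by (fastforce simp: cut_continuous_def)
next
  fix C assume "is_cut K C"
  then have "is_cut H {e \<in> edges H. g e \<in> C}"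
    using assms(2) unfolding cut_continuous_def by blast
  then have "is_cut G {e \<in> edges G. f e \<in> {e \<in> edges H. g e \<in> C}}"
    using assms(1) unfolding cut_continuous_def by blast
  moreover have "{e \<in> edges G. f e \<in> {e \<in> edges H. g e \<in> C}} = {e \<in> edges G. (g \<circ> f) e \<in> C}"
    using assms by (auto simp: cut_continuous_def)
  ultimately show "is_cut G {e \<in> edges G. (g \<circ> f) e \<in> C}" by simp
qed

lemma cc_equiv_sym: "G \<approx>\<^sub>c\<^sub>c H \<Longrightarrow> H \<approx>\<^sub>c\<^sub>c G"
  by (auto simp: cc_equiv_def)

lemma cc_equiv_trans: "G \<approx>\<^sub>c\<^sub>c H \<Longrightarrow> H \<approx>\<^sub>c\<^sub>c K \<Longrightarrow> G \<approx>\<^sub>c\<^sub>c K"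
  unfolding cc_equiv_def by (meson cut_continuous_comp)

lemma graph_hom_comp: "graph_hom G H \<phi> \<Longrightarrow> graph_hom H K \<psi> \<Longrightarrow> graph_hom G K (\<psi> \<circ> \<phi>)"
  by (force simp: graph_hom_def)

text \<open>A side \<open>Y\<close> of a cut pulls back to its preimage under
  \<open>\<phi>\<close>.\<close>

lemma graph_hom_cut_continuous:
  assumes G: "simple_graph G" and H: "simple_graph H" and hom: "graph_hom G H \<phi>"
  shows "cut_continuous G H ((`) \<phi>)"
proof (rule cut_continuousI[OF G])
  fix e assume e: "e \<in> edges G"
  with G obtain u v where "e = {u, v}" by (rule simple_graph_edgeE)
  then show "\<phi> ` e \<in> edges H" using e hom by (simp add: graph_hom_def)
next
  fix Y
  have "\<phi> ` {u, v} \<in> cut_of H Y \<longleftrightarrow>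
      (u \<in> {x \<in> verts G. \<phi> x \<in> Y}) \<noteq> (v \<in> {x \<in> verts G. \<phi> x \<in> Y})"
    if "{u, v} \<in> edges G" for u v
    using hom that edge_in_verts[OF G that] edge_in_cut_iff[OF H] by (simp add: graph_hom_def)
  then show "\<exists>X\<subseteq>verts G. \<forall>u v. {u, v} \<in> edges G \<longrightarrow>
      (\<phi> ` {u, v} \<in> cut_of H Y \<longleftrightarrow> (u \<in> X) \<noteq> (v \<in> X))"
    by (intro exI[of _ "{x \<in> verts G. \<phi> x \<in> Y}"]) blast
qed

section \<open>Walks of length three\<close>

definition joined3 :: "'a ugraph \<Rightarrow> 'a \<Rightarrow> 'a \<Rightarrow> bool" where
  "joined3 G u v \<longleftrightarrow> (\<exists>a b. {u, a} \<in> edges G \<and> {a, b} \<in> edges G \<and> {b, v} \<in> edges G)"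

lemma joined3I: "{u, a} \<in> edges G \<Longrightarrow> {a, b} \<in> edges G \<Longrightarrow> {b, v} \<in> edges G \<Longrightarrow> joined3 G u v"
  by (auto simp: joined3_def)

lemma joined3E:
  assumes "joined3 G u v"
  obtains a b where "{u, a} \<in> edges G" "{a, b} \<in> edges G" "{b, v} \<in> edges G"
  using assms by (auto simp: joined3_def)

text \<open>The walk runs back and forth: \<open>u\<close>, \<open>v\<close>, \<open>u\<close>,
  \<open>v\<close>.\<close>

lemma joined3_edge: "{u, v} \<in> edges G \<Longrightarrow> joined3 G u v"
  by (rule joined3I[of u v _ u]) (simp_all add: insert_commute)

lemma joined3_sym: "joined3 G u v \<Longrightarrow> joined3 G v u"
proof (elim joined3E)
  fix a b assume "{u, a} \<in> edges G" "{a, b} \<in> edges G" "{b, v} \<in> edges G"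
  then show "joined3 G v u" by (intro joined3I[of v b G a u]) (simp_all add: insert_commute)
qed

definition all_joined3 :: "'a ugraph \<Rightarrow> bool" where
  "all_joined3 G \<longleftrightarrow> (\<forall>u\<in>verts G. \<forall>v\<in>verts G. u \<noteq> v \<longrightarrow> joined3 G u v)"

text \<open>The vertices need not be distinct, so this also excludes loops.\<close>

definition triangle_free :: "'a ugraph \<Rightarrow> bool" where
  "triangle_free G \<longleftrightarrow> (\<nexists>x. joined3 G x x)"

lemma graph_hom_joined3: "graph_hom G H \<phi> \<Longrightarrow> joined3 G u v \<Longrightarrow> joined3 H (\<phi> u) (\<phi> v)"
proof (elim joined3E)
  fix a b assume "graph_hom G H \<phi>" "{u, a} \<in> edges G" "{a, b} \<in> edges G" "{b, v} \<in> edges G"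
  then show "joined3 H (\<phi> u) (\<phi> v)"
    by (intro joined3I[of "\<phi> u" "\<phi> a" H "\<phi> b" "\<phi> v"]) (simp_all add: graph_hom_def)
qed

text \<open>Closed walks of length three map to such walks. This carries triangle-freeness from the
  Petersen graph back to the dodecahedron and the 5-circuit.\<close>

lemma triangle_free_hom: "graph_hom G H \<phi> \<Longrightarrow> triangle_free H \<Longrightarrow> triangle_free G"
  unfolding triangle_free_def by (metis graph_hom_joined3)

text \<open>If the ends had the same image, the walk would become a closed walk of length three in
  \<open>H\<close>.\<close>

lemma graph_hom_separates:
  "graph_hom G H \<phi> \<Longrightarrow> triangle_free H \<Longrightarrow> joined3 G u v \<Longrightarrow> \<phi> u \<noteq> \<phi> v"
  by (metis graph_hom_joined3 triangle_free_def)

lemma graph_hom_inj_on: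
  "graph_hom G H \<phi> \<Longrightarrow> triangle_free H \<Longrightarrow> all_joined3 G \<Longrightarrow> inj_on \<phi> (verts G)"
  unfolding all_joined3_def by (metis graph_hom_separates inj_onI)

lemma no_graph_hom_card:
  assumes "all_joined3 G" "triangle_free H" "finite (verts H)" "card (verts H) < card (verts G)"
  shows "\<not> graph_hom G H \<phi>"
proof
  assume hom: "graph_hom G H \<phi>"
  then have "inj_on \<phi> (verts G)" using assms(1,2) graph_hom_inj_on by blast
  moreover have "\<phi> ` verts G \<subseteq> verts H" using hom by (simp add: graph_hom_def)
  ultimately have "card (verts G) \<le> card (verts H)" using assms(3) by (rule card_inj_on_le)
  with assms(4) show False by simp
qed

section \<open>The 5-circuit and the Groetzsch graph\<close>

lemma lessThan_5: "{..<5::nat} = {0, 1, 2, 3, 4}"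
  by auto

lemma edges_C5: "edges (cycle_graph 5) = {{0, 1}, {1, 2}, {2, 3}, {3, 4}, {4, 0}}"
proof -
  have "edges (cycle_graph 5) = (\<lambda>i. {i, Suc i mod 5}) ` {..<5}" by (auto simp: cycle_graph_def)
  also have "\<dots> = {{0, 1}, {1, 2}, {2, 3}, {3, 4}, {4, 0}}" by (simp add: lessThan_5 numeral_2_eq_2)
  finally show ?thesis .
qed

lemma verts_C5: "verts (cycle_graph 5) = {0, 1, 2, 3, 4}"
  by (simp add: cycle_graph_def lessThan_5)

lemma all_joined3_C5: "all_joined3 (cycle_graph 5)"
proof -
  let ?G = "cycle_graph 5"
  have "joined3 ?G 0 1" "joined3 ?G 1 2" "joined3 ?G 2 3" "joined3 ?G 3 4" "joined3 ?G 4 0"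
    by (rule joined3_edge; simp add: edges_C5)+
  \<comment> \<open>Vertices at distance two are joined the long way round the circuit.\<close>
  moreover have "joined3 ?G 0 2" "joined3 ?G 1 3" "joined3 ?G 2 4" "joined3 ?G 3 0" "joined3 ?G 4 1"
    by (rule joined3I[of 0 4 _ 3] joined3I[of 1 0 _ 4] joined3I[of 2 1 _ 0]
        joined3I[of 3 2 _ 1] joined3I[of 4 3 _ 2]; simp add: edges_C5 doubleton_eq_iff)+
  ultimately show ?thesis
    unfolding all_joined3_def verts_C5 by (auto intro: joined3_sym)
qed

lemma C5_three_neighbours:
  assumes "{x, a} \<in> edges (cycle_graph 5)" "{x, b} \<in> edges (cycle_graph 5)"
    "{x, c} \<in> edges (cycle_graph 5)"
  shows "a = b \<or> b = c \<or> c = a"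
  using assms unfolding edges_C5 by (auto simp: doubleton_eq_iff)

section \<open>Triangles and walks of length three in Mycielskians\<close>

lemma edges_mycielskian:
  "{Orig u, Orig v} \<in> edges (mycielskian G) \<longleftrightarrow> {u, v} \<in> edges G"
  "{Orig u, Copy v} \<in> edges (mycielskian G) \<longleftrightarrow> {u, v} \<in> edges G"
  "{Copy v, Orig u} \<in> edges (mycielskian G) \<longleftrightarrow> {u, v} \<in> edges G"
  "{Copy u, Apex} \<in> edges (mycielskian G) \<longleftrightarrow> u \<in> verts G"
  "{Apex, Copy u} \<in> edges (mycielskian G) \<longleftrightarrow> u \<in> verts G"
  "{Orig u, Apex} \<notin> edges (mycielskian G)" "{Apex, Orig u} \<notin> edges (mycielskian G)"
  "{Copy u, Copy v} \<notin> edges (mycielskian G)" "{Apex} \<notin> edges (mycielskian G)"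
  "{Copy u} \<notin> edges (mycielskian G)"
  by (auto simp: mycielskian_def doubleton_eq_iff insert_commute)

text \<open>Copies are pairwise non-adjacent and the apex sees only copies, so the apex lies in no
  triangle; replacing a copy by its original turns any other triangle into one of
  \<open>G\<close>.\<close>

lemma triangle_free_mycielskian:
  assumes "triangle_free G"
  shows "triangle_free (mycielskian G)"
  unfolding triangle_free_def
proof
  assume "\<exists>x. joined3 (mycielskian G) x x"
  then obtain x y z where "{x, y} \<in> edges (mycielskian G)" "{y, z} \<in> edges (mycielskian G)"
    "{z, x} \<in> edges (mycielskian G)"
    by (auto simp: joined3_def)
  then have "\<exists>a b c. {a, b} \<in> edges G \<and> {b, c} \<in> edges G \<and> {c, a} \<in> edges G"
    by (cases x; cases y; cases z) (auto simp: edges_mycielskian insert_commute)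
  with assms show False by (auto simp: triangle_free_def joined3_def)
qed

lemma all_joined3_mycielskian:
  assumes G: "simple_graph G" and joined: "all_joined3 G"
    and nbr: "\<And>u. u \<in> verts G \<Longrightarrow> \<exists>w. {u, w} \<in> edges G"
  shows "all_joined3 (mycielskian G)"
proof -
  let ?M = "mycielskian G"
  have oo: "joined3 ?M (Orig u) (Orig v)" if "joined3 G u v" for u v
    using that by (auto simp: joined3_def) (metis edges_mycielskian(1))
  \<comment> \<open>A walk in \<open>G\<close> lifts with its two inner vertices taken as
    originals.\<close>
  have cc: "joined3 ?M (Copy u) (Copy v)" if uv: "joined3 G u v" for u v
  proof -
    obtain a b where "{u, a} \<in> edges G" "{a, b} \<in> edges G" "{b, v} \<in> edges G"
      using uv by (rule joined3E)
    then show ?thesis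
      by (intro joined3I[of _ "Orig a" _ "Orig b"]) (simp_all add: edges_mycielskian insert_commute)
  qed
  \<comment> \<open>The detour through the apex also covers \<open>u = v\<close>: an original and
    its copy are distinct, but \<open>joined\<close> gives no walk from a vertex of \<open>G\<close>
    to itself.\<close>
  have oc: "joined3 ?M (Orig u) (Copy v)" if uv: "u \<in> verts G" "v \<in> verts G" for u v
  proof -
    obtain w where "{u, w} \<in> edges G" using nbr uv(1) by blast
    with uv edge_in_verts[OF G this] show ?thesis
      by (intro joined3I[of _ "Copy w" _ Apex]) (simp_all add: edges_mycielskian)
  qed
  have oa: "joined3 ?M (Orig u) Apex" if u: "u \<in> verts G" for u
  proof -
    obtain w where "{u, w} \<in> edges G" using nbr u by blast
    with u show ?thesis
      by (intro joined3I[of _ "Orig w" _ "Copy u"]) (simp_all add: edges_mycielskian insert_commute)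
  qed
  have ca: "joined3 ?M (Copy u) Apex" if "u \<in> verts G" for u
    using that by (intro joined3_edge) (simp add: edges_mycielskian)
  have "joined3 ?M x y" if "x \<in> verts ?M" "y \<in> verts ?M" "x \<noteq> y" for x y
    using that joined oo cc oc oa ca oc[THEN joined3_sym] oa[THEN joined3_sym] ca[THEN joined3_sym]
    by (cases x; cases y) (auto simp: mycielskian_def all_joined3_def)
  then show ?thesis by (simp add: all_joined3_def)
qed

lemma all_joined3_groetzsch: "all_joined3 groetzsch"
  unfolding groetzsch_def
  by (rule all_joined3_mycielskian[OF simple_graph_cycle_graph all_joined3_C5])
    (auto simp: cycle_graph_def)

lemma card_groetzsch: "card (verts groetzsch) = 11"
  by (simp add: groetzsch_def mycielskian_def verts_C5)

section \<open>The Petersen graph\<close>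

lemma edges_petersen:
  "{A, B} \<in> edges petersen \<longleftrightarrow>
    A \<subseteq> {..<5} \<and> card A = 2 \<and> B \<subseteq> {..<5} \<and> card B = 2 \<and> A \<inter> B = {}"
  by (auto simp: petersen_def doubleton_eq_iff)

lemma card_petersen: "card (verts petersen) = 10"
  by (simp add: petersen_def n_subsets numeral_eq_Suc)

text \<open>The neighbours of \<open>A\<close> are the 2-subsets of its three-element
  complement.\<close>

lemma card_petersen_neighbours:
  assumes "A \<in> verts petersen"
  shows "card {B. {A, B} \<in> edges petersen} = 3"
proof -
  have A: "A \<subseteq> {..<5}" "card A = 2" using assms by (auto simp: petersen_def)
  then have "{B. {A, B} \<in> edges petersen} = {B. B \<subseteq> {..<5} - A \<and> card B = 2}"
    by (auto simp: edges_petersen)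
  moreover have "card ({..<5} - A) = 3" using A by (simp add: card_Diff_subset finite_subset)
  ultimately show ?thesis by (simp add: n_subsets numeral_eq_Suc)
qed

text \<open>Three pairwise disjoint pairs would need six elements.\<close>

lemma triangle_free_petersen: "triangle_free petersen"
  unfolding triangle_free_def
proof
  assume "\<exists>A. joined3 petersen A A"
  then obtain A B C where *: "{A, B} \<in> edges petersen" "{B, C} \<in> edges petersen"
    "{C, A} \<in> edges petersen"
    by (auto simp: joined3_def)
  then have fin: "finite A" "finite B" "finite C"
    unfolding edges_petersen by (auto intro: finite_subset)
  have "card (A \<union> B \<union> C) = 6"
    using * fin unfolding edges_petersen by (subst card_Un_disjoint; auto simp: card_Un_disjoint)
  moreover have "card (A \<union> B \<union> C) \<le> card {..<5::nat}"
    using * unfolding edges_petersen by (intro card_mono) auto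
  ultimately show False by simp
qed

lemma all_joined3_petersen: "all_joined3 petersen"
  unfolding all_joined3_def
proof (intro ballI impI)
  fix A B assume "A \<in> verts petersen" "B \<in> verts petersen" and ne: "A \<noteq> B"
  then have A: "A \<subseteq> {..<5}" "card A = 2" and B: "B \<subseteq> {..<5}" "card B = 2"
    by (auto simp: petersen_def)
  show "joined3 petersen A B"
  proof (cases "A \<inter> B = {}")
    case True
    then show ?thesis using A B by (intro joined3_edge) (simp add: edges_petersen)
  next
    case False
    then obtain x where x: "x \<in> A" "x \<in> B" by blast
    obtain a where a: "A = {x, a}" "a \<noteq> x" using A(2) x(1) by (auto simp: card_2_iff)
    obtain b where b: "B = {x, b}" "b \<noteq> x" using B(2) x(2) by (auto simp: card_2_iff)
    have ab: "a \<noteq> b" using ne a b by auto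
    \<comment> \<open>The two remaining elements \<open>c\<close> and \<open>d\<close> give the walk
      \<open>{x, a}\<close>, \<open>{b, c}\<close>, \<open>{a, d}\<close>, \<open>{x, b}\<close>, in
      which consecutive pairs are disjoint.\<close>
    have "card ({..<5} - {x, a, b}) = 2"
      using A(1) B(1) a b ab by (subst card_Diff_subset) auto
    then obtain c d where cd: "{..<5} - {x, a, b} = {c, d}" "c \<noteq> d" by (auto simp: card_2_iff)
    then have "c \<in> {..<5} - {x, a, b}" "d \<in> {..<5} - {x, a, b}" by auto
    then show ?thesis
      using A(1) B(1) a b ab cd(2)
      by (intro joined3I[of _ "{b, c}" _ "{a, d}"]) (auto simp: edges_petersen)
  qed
qed

section \<open>The Clebsch graph\<close>

text \<open>The symmetric difference with \<open>{i}\<close>: a step of the cube along coordinate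
  \<open>i\<close>.\<close>

definition flip :: "'a \<Rightarrow> 'a set \<Rightarrow> 'a set" where
  "flip i A = (if i \<in> A then A - {i} else insert i A)"

lemma antipodal_class_complement:
  "A \<subseteq> {..<5} \<Longrightarrow> antipodal_class ({..<5} - A) = antipodal_class A"
  by (simp add: antipodal_class_def double_diff insert_commute)

text \<open>Complementing one of two sets at distance four leaves its class unchanged and brings the
  distance down to one.\<close>

lemma clebsch_edgeI:
  assumes A: "A \<subseteq> {..<5}" and B: "B \<subseteq> {..<5}"
    and card: "card ((A - B) \<union> (B - A)) = 1 \<or> card ((A - B) \<union> (B - A)) = 4"
  shows "{antipodal_class A, antipodal_class B} \<in> edges clebsch"
proof -
  have one: "{antipodal_class A, antipodal_class B} \<in> edges clebsch"
    if "A \<subseteq> {..<5}" "B \<subseteq> {..<5}" "card ((A - B) \<union> (B - A)) = 1" for A B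
    unfolding clebsch_def ugraph.simps mem_Collect_eq using that by blast
  from card show ?thesis
  proof
    assume "card ((A - B) \<union> (B - A)) = 1"
    with A B show ?thesis by (rule one)
  next
    let ?B = "{..<5} - B"
    assume "card ((A - B) \<union> (B - A)) = 4"
    then have "card ({..<5} - ((A - B) \<union> (B - A))) = 1"
      using A B by (subst card_Diff_subset) (auto intro: finite_subset[of _ "{..<5}"])
    moreover have "{..<5} - ((A - B) \<union> (B - A)) = (A - ?B) \<union> (?B - A)" using A B by auto
    ultimately have "{antipodal_class A, antipodal_class ?B} \<in> edges clebsch"
      by (intro one A) simp_all
    then show ?thesis by (simp add: antipodal_class_complement B)
  qed
qed

lemma flip_edge_clebsch:
  assumes "A \<subseteq> {..<5}" "i < 5"
  shows "{antipodal_class A, antipodal_class (flip i A)} \<in> edges clebsch"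
proof -
  have "flip i A \<subseteq> {..<5}" "(A - flip i A) \<union> (flip i A - A) = {i}"
    using assms by (auto simp: flip_def)
  then show ?thesis using assms(1) by (intro clebsch_edgeI) simp_all
qed

text \<open>Supplies the flipped coordinate on which the map to the 5-circuit is built.\<close>

lemma clebsch_edgeE:
  assumes "e \<in> edges clebsch"
  obtains A i where "A \<subseteq> {..<5}" "i < 5" "e = {antipodal_class A, antipodal_class (flip i A)}"
proof -
  obtain A B where AB: "A \<subseteq> {..<5}" "B \<subseteq> {..<5}" "e = {antipodal_class A, antipodal_class B}"
    "card ((A - B) \<union> (B - A)) = 1"
    using assms unfolding clebsch_def ugraph.simps mem_Collect_eq by (elim exE conjE)
  then obtain i where i: "(A - B) \<union> (B - A) = {i}" by (meson card_1_singletonE)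
  then have "x \<in> B \<longleftrightarrow> (x \<in> A) \<noteq> (x = i)" for x by blast
  then have "B = flip i A" by (auto simp: flip_def)
  moreover have "i < 5" using i AB(1,2) by auto
  ultimately show thesis using AB that by blast
qed

text \<open>The subsets avoiding \<open>4\<close> lie in pairwise different classes, because their
  complements contain \<open>4\<close>.\<close>

lemma card_clebsch: "card (verts clebsch) \<ge> 16"
proof -
  have "inj_on antipodal_class (Pow {..<4})"
    by (rule inj_onI) (auto simp: antipodal_class_def doubleton_eq_iff)
  then have "card (antipodal_class ` Pow {..<4}) = 16" by (simp add: card_image card_Pow)
  moreover have "antipodal_class ` Pow {..<4} \<subseteq> verts clebsch"
    unfolding clebsch_def ugraph.simps by (intro image_mono) auto
  moreover have "finite (verts clebsch)" by (simp add: clebsch_def)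
  ultimately show ?thesis by (metis card_mono)
qed

text \<open>Complementing one representative turns distance \<open>d\<close> into
  \<open>5 - d\<close>, so the distance may be taken odd. It is not five, as the classes differ;
  distance one is an edge, and distance three is bridged by three flips.\<close>

lemma all_joined3_clebsch: "all_joined3 clebsch"
proof -
  have odd: "joined3 clebsch (antipodal_class A) (antipodal_class B)"
    if A: "A \<subseteq> {..<5}" and B: "B \<subseteq> {..<5}" and ne: "antipodal_class A \<noteq> antipodal_class B"
      and odd: "odd (card ((A - B) \<union> (B - A)))" for A B
  proof -
    let ?D = "(A - B) \<union> (B - A)"
    have D: "?D \<subseteq> {..<5}" using A B by auto
    have "card ?D \<noteq> 5"
    proof
      assume "card ?D = 5"
      then have "?D = {..<5}" using D by (intro card_subset_eq) auto
      then have "B = {..<5} - A" using A B by blast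
      then show False using ne antipodal_class_complement[OF A] by simp
    qed
    moreover have "card ?D \<le> 5" using card_mono[OF _ D] by simp
    moreover have "n = 1 \<or> n = 3" if "odd n" "n \<noteq> 5" "n \<le> 5" for n :: nat
      using that by presburger
    ultimately have "card ?D = 1 \<or> card ?D = 3" using odd by blast
    then show ?thesis
    proof
      assume "card ?D = 1"
      then show ?thesis using A B by (intro joined3_edge clebsch_edgeI) simp_all
    next
      assume "card ?D = 3"
      then obtain i j k where ijk: "?D = {i, j, k}" "i \<noteq> j" "i \<noteq> k" "j \<noteq> k"
        by (auto simp: card_3_iff)
      then have le: "i < 5" "j < 5" "k < 5" using D by auto
      have "B = (A - ?D) \<union> (?D - A)" by blast
      also have "\<dots> = flip k (flip j (flip i A))"
        using ijk(2-4) unfolding ijk(1) by (auto simp: flip_def)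
      finally have B': "B = flip k (flip j (flip i A))" .
      have sub: "flip m X \<subseteq> {..<5}" if "X \<subseteq> {..<5}" "m < 5" for m and X :: "nat set"
        using that by (auto simp: flip_def)
      show ?thesis
        unfolding B' using A le sub
        by (intro joined3I[of _ "antipodal_class (flip i A)" _ "antipodal_class (flip j (flip i A))"]
            flip_edge_clebsch) auto
    qed
  qed
  have "joined3 clebsch (antipodal_class A) (antipodal_class B)"
    if A: "A \<subseteq> {..<5}" and B: "B \<subseteq> {..<5}" and ne: "antipodal_class A \<noteq> antipodal_class B" for A B
  proof (cases "odd (card ((A - B) \<union> (B - A)))")
    case True
    with A B ne show ?thesis by (rule odd)
  next
    case False
    let ?B = "{..<5} - B"
    have "(A - ?B) \<union> (?B - A) = {..<5} - ((A - B) \<union> (B - A))" using A B by auto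
    moreover have "card \<dots> = 5 - card ((A - B) \<union> (B - A))"
      using A B by (subst card_Diff_subset) (auto intro: finite_subset[of _ "{..<5}"])
    moreover have "card ((A - B) \<union> (B - A)) \<le> card {..<5::nat}"
      using A B by (intro card_mono) auto
    ultimately have "odd (card ((A - ?B) \<union> (?B - A)))" using False by simp
    then have "joined3 clebsch (antipodal_class A) (antipodal_class ?B)"
      using A ne antipodal_class_complement[OF B] by (intro odd) auto
    then show ?thesis using antipodal_class_complement[OF B] by simp
  qed
  then show ?thesis by (auto simp: all_joined3_def clebsch_def)
qed

section \<open>The cut-continuous map from the Clebsch graph to the 5-circuit\<close>

lemma even_card_cut_C5:
  "even (card {i. i < 5 \<and> (i \<in> X) \<noteq> (Suc i mod 5 \<in> X)})"
proof -
  let ?P = "\<lambda>i. (i \<in> X) \<noteq> (Suc i mod 5 \<in> X)"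
  have "{i. i < 5 \<and> ?P i} = {..<5} \<inter> Collect ?P" by auto
  then have "card {i. i < 5 \<and> ?P i} = (\<Sum>i<5. of_bool (?P i))" by (simp add: sum_of_bool_eq)
  \<comment> \<open>Once around the circuit the walk is back on its initial side, so it changes
    sides an even number of times; this is checked for all 32 choices of sides.\<close>
  also have "even \<dots>"
    unfolding lessThan_5
    by (cases "0 \<in> X"; cases "1 \<in> X"; cases "2 \<in> X"; cases "3 \<in> X"; cases "4 \<in> X")
      (simp_all add: numeral_2_eq_2[symmetric])
  finally show ?thesis .
qed

lemma cut_continuous_clebsch_C5: "\<exists>f. cut_continuous clebsch (cycle_graph 5) f"
proof -
  have "\<exists>i A. e \<in> edges clebsch \<longrightarrow>
      i < 5 \<and> A \<subseteq> {..<5} \<and> e = {antipodal_class A, antipodal_class (flip i A)}" for e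
    using clebsch_edgeE by metis
  then obtain c R where c: "\<And>e. e \<in> edges clebsch \<Longrightarrow>
      c e < 5 \<and> R e \<subseteq> {..<5} \<and> e = {antipodal_class (R e), antipodal_class (flip (c e) (R e))}"
    by metis
  have "cut_continuous clebsch (cycle_graph 5) (\<lambda>e. {c e, Suc (c e) mod 5})"
  proof (rule cut_continuousI[OF simple_graph_clebsch])
    fix e assume "e \<in> edges clebsch"
    then show "{c e, Suc (c e) mod 5} \<in> edges (cycle_graph 5)"
      using c by (auto simp: cycle_graph_def)
  next
    fix Y :: "nat set"
    \<comment> \<open>The cut given by \<open>Y\<close>, with \<open>i\<close> standing for the edge
      from \<open>i\<close> to \<open>Suc i mod 5\<close>.\<close>
    define S where "S = {i. i < 5 \<and> (i \<in> Y) \<noteq> (Suc i mod 5 \<in> Y)}"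
    have S: "S \<subseteq> {..<5}" "even (card S)" using even_card_cut_C5 by (auto simp: S_def)
    then have "finite S" by (auto intro: finite_subset)
    define X where "X = antipodal_class ` {A. A \<subseteq> {..<5} \<and> even (card (A \<inter> S))}"
    \<comment> \<open>Evenness of \<open>card S\<close> makes membership in \<open>X\<close>
      independent of the representative of a class.\<close>
    have compl: "even (card (({..<5} - A) \<inter> S)) \<longleftrightarrow> even (card (A \<inter> S))" for A
    proof -
      have "card S = card (({..<5} - A) \<inter> S) + card (A \<inter> S)"
        using S(1) \<open>finite S\<close> by (subst card_Un_disjoint[symmetric]) (auto intro: arg_cong[of _ _ card])
      then show ?thesis using S(2) by (metis even_add)
    qed
    have X_iff: "antipodal_class A \<in> X \<longleftrightarrow> even (card (A \<inter> S))" if "A \<subseteq> {..<5}" for A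
      using that compl unfolding X_def antipodal_class_def image_iff
      by (auto simp: doubleton_eq_iff)
    \<comment> \<open>Flipping coordinate \<open>i\<close> changes the parity exactly when edge
      \<open>i\<close> is in the cut.\<close>
    have flip_iff: "even (card (flip i A \<inter> S)) \<longleftrightarrow> (even (card (A \<inter> S)) \<noteq> (i \<in> S))" for i A
    proof -
      consider "i \<notin> S" "flip i A \<inter> S = A \<inter> S"
        | "i \<in> S" "i \<in> A" "A \<inter> S = insert i (flip i A \<inter> S)" "i \<notin> flip i A"
        | "i \<in> S" "i \<notin> A" "flip i A \<inter> S = insert i (A \<inter> S)"
        by (cases "i \<in> S"; cases "i \<in> A") (auto simp: flip_def)
      then show ?thesis using \<open>finite S\<close> by cases auto
    qed
    have "{c e, Suc (c e) mod 5} \<in> cut_of (cycle_graph 5) Y \<longleftrightarrow> (u \<in> X) \<noteq> (v \<in> X)"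
      if e: "e \<in> edges clebsch" "e = {u, v}" for e u v
    proof -
      have flip_sub: "flip (c e) (R e) \<subseteq> {..<5}" using c[OF e(1)] by (auto simp: flip_def)
      have "{c e, Suc (c e) mod 5} \<in> edges (cycle_graph 5)"
        using c[OF e(1)] by (auto simp: cycle_graph_def)
      then have "{c e, Suc (c e) mod 5} \<in> cut_of (cycle_graph 5) Y \<longleftrightarrow> c e \<in> S"
        using c[OF e(1)] by (subst edge_in_cut_iff[OF simple_graph_cycle_graph]) (auto simp: S_def)
      also have "\<dots> \<longleftrightarrow>
          (antipodal_class (R e) \<in> X) \<noteq> (antipodal_class (flip (c e) (R e)) \<in> X)"
        using c[OF e(1)] X_iff flip_sub flip_iff by auto
      also have "\<dots> \<longleftrightarrow> (u \<in> X) \<noteq> (v \<in> X)"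
        using c[OF e(1)] e(2) by (metis doubleton_eq_iff)
      finally show ?thesis .
    qed
    moreover have "X \<subseteq> verts clebsch" by (auto simp: X_def clebsch_def)
    ultimately show "\<exists>X\<subseteq>verts clebsch. \<forall>u v. {u, v} \<in> edges clebsch \<longrightarrow>
        ({c {u, v}, Suc (c {u, v}) mod 5} \<in> cut_of (cycle_graph 5) Y \<longleftrightarrow> (u \<in> X) \<noteq> (v \<in> X))"
      by blast
  qed
  then show ?thesis by blast
qed

section \<open>Homomorphisms between the five graphs\<close>

lemma graph_homI:
  assumes "\<And>v. v \<in> verts G \<Longrightarrow> \<phi> v \<in> verts H"
    and "\<And>e. e \<in> edges G \<Longrightarrow> \<phi> ` e \<in> edges H"
  shows "graph_hom G H \<phi>"
  using assms(1) assms(2)[of "{_, _}"] by (auto simp: graph_hom_def)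

lemma graph_hom_C5_dodecahedron: "graph_hom (cycle_graph 5) dodecahedron (\<lambda>v. v)"
proof (rule graph_homI)
  show "v \<in> verts dodecahedron" if "v \<in> verts (cycle_graph 5)" for v
    using that by (auto simp: verts_C5 dodecahedron_def)
  have "edges (cycle_graph 5) \<subseteq> edges dodecahedron"
    unfolding edges_C5 dodecahedron_edges_explicit by (simp only: insert_subset empty_subsetI) simp
  then show "(\<lambda>v. v) ` e \<in> edges dodecahedron" if "e \<in> edges (cycle_graph 5)" for e
    using that by auto
qed

lemma graph_hom_C5_groetzsch: "graph_hom (cycle_graph 5) groetzsch Orig"
  by (auto simp: graph_hom_def groetzsch_def edges_mycielskian) (simp add: mycielskian_def)

text \<open>Antipodal vertices of the dodecahedron have the same image.\<close>

lemma graph_hom_dodecahedron_petersen: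
  "graph_hom dodecahedron petersen
    (\<lambda>v. [{0, 2}, {1, 3}, {2, 4}, {3, 0}, {4, 1},
          {3, 4}, {4, 0}, {0, 1}, {1, 2}, {2, 3},
          {1, 2}, {2, 3}, {3, 4}, {4, 0}, {0, 1},
          {0, 3}, {1, 4}, {2, 0}, {3, 1}, {4, 2}] ! v)"
  (is "graph_hom _ _ ?\<phi>")
proof (rule graph_homI)
  have "\<forall>e\<in>edges dodecahedron. ?\<phi> ` e \<in> edges petersen"
    unfolding dodecahedron_edges_explicit by (simp add: edges_petersen)
  then show "?\<phi> ` e \<in> edges petersen" if "e \<in> edges dodecahedron" for e
    using that by blast
next
  have "\<forall>v\<in>set [0..<20]. ?\<phi> v \<in> verts petersen"
    by (simp add: petersen_def upt_rec)
  then show "?\<phi> v \<in> verts petersen" if "v \<in> verts dodecahedron" for v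
    using that by (simp add: dodecahedron_def)
qed

text \<open>Disjoint pairs are at distance four in the cube, hence adjacent after folding.\<close>

lemma graph_hom_petersen_clebsch: "graph_hom petersen clebsch antipodal_class"
  unfolding graph_hom_def
proof (intro conjI allI impI)
  show "antipodal_class ` verts petersen \<subseteq> verts clebsch" by (auto simp: petersen_def clebsch_def)
next
  fix A B assume "{A, B} \<in> edges petersen"
  then have AB: "A \<subseteq> {..<5}" "B \<subseteq> {..<5}" "card A = 2" "card B = 2" "A \<inter> B = {}"
    by (auto simp: edges_petersen)
  then have "(A - B) \<union> (B - A) = A \<union> B" "finite A" "finite B" by (auto intro: finite_subset)
  then have "card ((A - B) \<union> (B - A)) = 4" using AB by (simp add: card_Un_disjoint)
  then show "{antipodal_class A, antipodal_class B} \<in> edges clebsch"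
    using AB by (intro clebsch_edgeI) auto
qed

text \<open>
  The neighbours of the class of the empty set are the classes of singletons; the classes of
  2-subsets form a Petersen graph, in which the original 5-circuit is placed.
\<close>

lemma graph_hom_groetzsch_clebsch:
  "graph_hom groetzsch clebsch
    (\<lambda>x. antipodal_class (case x of
        Orig u \<Rightarrow> [{0, 1}, {2, 3}, {4, 0}, {1, 2}, {3, 4}] ! u
      | Copy u \<Rightarrow> [{3}, {0}, {2}, {4}, {1}] ! u
      | Apex \<Rightarrow> {}))"
  (is "graph_hom _ _ (\<lambda>x. antipodal_class (?h x))")
proof -
  have sub: "?h x \<subseteq> {..<5}" if "x \<in> verts groetzsch" for x
    using that by (auto simp: groetzsch_def mycielskian_def verts_C5)
  have "{antipodal_class (?h x), antipodal_class (?h y)} \<in> edges clebsch"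
    if xy: "{x, y} \<in> edges groetzsch" for x y
  proof (rule clebsch_edgeI)
    show "?h x \<subseteq> {..<5}" "?h y \<subseteq> {..<5}"
      using edge_in_verts[OF simple_graph_groetzsch xy] sub by blast+
    \<comment> \<open>Edges between originals join disjoint pairs, at distance four. The singleton
      at \<open>Copy u\<close> is the common element of the pairs at the two neighbours of
      \<open>u\<close>, so all other edges have distance one.\<close>
    show "card ((?h x - ?h y) \<union> (?h y - ?h x)) = 1 \<or> card ((?h x - ?h y) \<union> (?h y - ?h x)) = 4"
      using xy unfolding groetzsch_def
      by (cases x; cases y)
        (auto simp: edges_mycielskian edges_C5 verts_C5 doubleton_eq_iff insert_Diff_if)
  qed
  then show ?thesis using sub by (auto simp: graph_hom_def clebsch_def)
qed

section \<open>The dodecahedron\<close>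

lemma card_dodecahedron_neighbours:
  assumes "v \<in> verts dodecahedron"
  shows "card {w. {v, w} \<in> edges dodecahedron} \<le> 3"
proof -
  \<comment> \<open>Each edge is listed in one orientation; adding the swapped pairs makes the
    neighbours of a vertex computable by filtering.\<close>
  define L :: "(nat \<times> nat) list" where "L =
    [(0, 1), (1, 2), (2, 3), (3, 4), (4, 0), (0, 5), (1, 6), (2, 7), (3, 8), (4, 9),
     (5, 10), (10, 6), (6, 11), (11, 7), (7, 12), (12, 8), (8, 13), (13, 9), (9, 14), (14, 5),
     (10, 15), (11, 16), (12, 17), (13, 18), (14, 19),
     (15, 16), (16, 17), (17, 18), (18, 19), (19, 15)]"
  let ?N = "\<lambda>v. map snd (filter (\<lambda>p. fst p = v) (L @ map prod.swap L))"
  have E: "edges dodecahedron = (\<lambda>(a, b). {a, b}) ` set L"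
    unfolding dodecahedron_edges_explicit L_def by simp
  have "w \<in> set (?N v)" if "{v, w} \<in> edges dodecahedron" for w
  proof -
    have "(v, w) \<in> set L \<or> (w, v) \<in> set L" using that unfolding E by (auto simp: doubleton_eq_iff)
    then have "(v, w) \<in> set (L @ map prod.swap L)" by auto
    then have "(v, w) \<in> set (filter (\<lambda>p. fst p = v) (L @ map prod.swap L))" by simp
    then show ?thesis unfolding set_map by (rule rev_image_eqI) simp
  qed
  then have "{w. {v, w} \<in> edges dodecahedron} \<subseteq> set (?N v)" by blast
  then have "card {w. {v, w} \<in> edges dodecahedron} \<le> length (?N v)"
    by (rule order_trans[OF card_mono[OF finite_set] card_length])
  moreover have "\<forall>v\<in>set [0..<20]. length (?N v) = 3"
    unfolding L_def by code_simp
  then have "length (?N v) = 3" using assms by (simp add: dodecahedron_def)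
  ultimately show ?thesis by simp
qed

lemma no_hom_petersen_dodecahedron: "\<not> graph_hom petersen dodecahedron \<phi>"
proof
  assume hom: "graph_hom petersen dodecahedron \<phi>"
  have "triangle_free dodecahedron"
    using graph_hom_dodecahedron_petersen triangle_free_petersen by (rule triangle_free_hom)
  then have inj: "inj_on \<phi> (verts petersen)"
    using graph_hom_inj_on hom all_joined3_petersen by blast
  define S where "S = \<phi> ` verts petersen"
  have card_S: "card S = 10" using inj by (simp add: S_def card_image card_petersen)
  \<comment> \<open>The three neighbours of \<open>A\<close> have distinct images, which exhaust the
    at most three neighbours of \<open>v\<close>.\<close>
  have closed: "w \<in> S" if vw: "v \<in> S" "{v, w} \<in> edges dodecahedron" for v w
  proof -
    obtain A where A: "A \<in> verts petersen" "v = \<phi> A" using vw(1) by (auto simp: S_def)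
    let ?N = "{B. {A, B} \<in> edges petersen}" and ?M = "{w. {v, w} \<in> edges dodecahedron}"
    have N: "?N \<subseteq> verts petersen" using edge_in_verts[OF simple_graph_petersen] by blast
    have "finite ?M"
      using edge_in_verts[OF simple_graph_dodecahedron] simple_graph_dodecahedron
      by (auto simp: simple_graph_def intro: finite_subset[of _ "verts dodecahedron"])
    moreover have "\<phi> ` ?N \<subseteq> ?M" using hom A by (auto simp: graph_hom_def)
    moreover have "card (\<phi> ` ?N) = 3"
      using card_petersen_neighbours[OF A(1)] inj_on_subset[OF inj N] by (simp add: card_image)
    ultimately have "\<phi> ` ?N = ?M"
      using card_dodecahedron_neighbours[of v] edge_in_verts[OF simple_graph_dodecahedron vw(2)]
      by (intro card_seteq) auto
    then show "w \<in> S" using vw(2) N by (auto simp: S_def)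
  qed
  have closed_iff: "v \<in> S \<longleftrightarrow> w \<in> S" if "{v, w} \<in> edges dodecahedron" for v w
  proof -
    have "{w, v} \<in> edges dodecahedron" using that by (simp add: insert_commute)
    with that show ?thesis using closed by blast
  qed
  have sub: "S \<subseteq> {..<20}" using hom by (auto simp: S_def graph_hom_def dodecahedron_def)
  \<comment> \<open>Parent map of a spanning tree rooted at \<open>0\<close>: along the top face,
    and from lower layers straight up. It decreases the number of the vertex, so induction gives
    connectedness.\<close>
  let ?p = "\<lambda>v::nat. if v < 5 then v - 1 else v - 5"
  have "\<forall>v\<in>set [0..<20]. v \<noteq> 0 \<longrightarrow> {v, ?p v} \<in> edges dodecahedron"
    unfolding dodecahedron_edges_explicit by (simp add: upt_rec doubleton_eq_iff)
  then have "{v, ?p v} \<in> edges dodecahedron" if "0 < v" "v < 20" for v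
    using that by simp
  then have step: "v \<in> S \<longleftrightarrow> ?p v \<in> S" if "0 < v" "v < 20" for v
    using closed_iff that by blast
  have "v \<in> S \<longleftrightarrow> 0 \<in> S" if "v < 20" for v
    using that
  proof (induction v rule: less_induct)
    case (less v)
    show ?case
    proof (cases "v = 0")
      case False
      then have "v \<in> S \<longleftrightarrow> ?p v \<in> S" using step less.prems by blast
      moreover have "?p v < v" "?p v < 20" using False less.prems by auto
      ultimately show ?thesis using less.IH by blast
    qed simp
  qed
  then have "S = {} \<or> S = {..<20}" using sub by auto
  with card_S show False by auto
qed

lemma no_hom_dodecahedron_C5: "\<not> graph_hom dodecahedron (cycle_graph 5) \<phi>"
proof
  assume hom: "graph_hom dodecahedron (cycle_graph 5) \<phi>"
  have "triangle_free (cycle_graph 5)"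
    using graph_hom_comp[OF graph_hom_C5_dodecahedron graph_hom_dodecahedron_petersen]
      triangle_free_petersen by (rule triangle_free_hom)
  note separates = graph_hom_separates[OF hom this]
  \<comment> \<open>Any two of the neighbours \<open>1\<close>, \<open>4\<close>, \<open>5\<close>
    of \<open>0\<close> lie with it on a pentagon, and the rest of that pentagon is a walk of length
    three between them.\<close>
  have "joined3 dodecahedron 1 4" "joined3 dodecahedron 4 5" "joined3 dodecahedron 5 1"
    by (rule joined3I[of 1 2 _ 3] joined3I[of 4 9 _ 14] joined3I[of 5 10 _ 6];
        simp add: dodecahedron_edges_explicit doubleton_eq_iff)+
  then have "\<phi> 1 \<noteq> \<phi> 4" "\<phi> 4 \<noteq> \<phi> 5" "\<phi> 5 \<noteq> \<phi> 1" by (auto dest: separates)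
  moreover have "{0, 1} \<in> edges dodecahedron" "{0, 4} \<in> edges dodecahedron"
    "{0, 5} \<in> edges dodecahedron"
    by (simp_all add: dodecahedron_edges_explicit doubleton_eq_iff)
  then have "{\<phi> 0, \<phi> 1} \<in> edges (cycle_graph 5)" "{\<phi> 0, \<phi> 4} \<in> edges (cycle_graph 5)"
    "{\<phi> 0, \<phi> 5} \<in> edges (cycle_graph 5)"
    using hom by (simp_all add: graph_hom_def)
  ultimately show False using C5_three_neighbours by blast
qed

section \<open>Combining the homomorphisms, the coordinate map and the obstructions\<close>

theorem theorem6:
  "(petersen \<approx>\<^sub>c\<^sub>c clebsch \<and>
    clebsch \<approx>\<^sub>c\<^sub>c groetzsch \<and>
    groetzsch \<approx>\<^sub>c\<^sub>c dodecahedron \<and>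
    dodecahedron \<approx>\<^sub>c\<^sub>c cycle_graph 5) \<and>
   \<not> hom_equiv petersen clebsch \<and>
   \<not> hom_equiv petersen groetzsch \<and>
   \<not> hom_equiv petersen dodecahedron \<and>
   \<not> hom_equiv petersen (cycle_graph 5) \<and>
   \<not> hom_equiv clebsch groetzsch \<and>
   \<not> hom_equiv clebsch dodecahedron \<and>
   \<not> hom_equiv clebsch (cycle_graph 5) \<and>
   \<not> hom_equiv groetzsch dodecahedron \<and>
   \<not> hom_equiv groetzsch (cycle_graph 5) \<and>
   \<not> hom_equiv dodecahedron (cycle_graph 5)"
proof -
  note simple = simple_graph_petersen simple_graph_clebsch simple_graph_groetzsch
    simple_graph_dodecahedron simple_graph_cycle_graph[of 5, simplified]
  note C5_P = graph_hom_comp[OF graph_hom_C5_dodecahedron graph_hom_dodecahedron_petersen]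
  \<comment> \<open>Every graph between the 5-circuit and the Clebsch graph in the homomorphism
    order is equivalent to the circuit, since the coordinate map leads back from the Clebsch
    graph.\<close>
  have C5: "G \<approx>\<^sub>c\<^sub>c cycle_graph 5"
    if "simple_graph G" "graph_hom G clebsch \<phi>" "graph_hom (cycle_graph 5) G \<psi>"
    for G :: "'v ugraph" and \<phi> \<psi>
    using that simple cut_continuous_clebsch_C5 unfolding cc_equiv_def
    by (meson cut_continuous_comp graph_hom_cut_continuous)
  have P: "petersen \<approx>\<^sub>c\<^sub>c cycle_graph 5"
    using simple(1) graph_hom_petersen_clebsch C5_P by (rule C5)
  have Cl: "clebsch \<approx>\<^sub>c\<^sub>c cycle_graph 5"
    by (rule C5[OF simple(2) _ graph_hom_comp[OF C5_P graph_hom_petersen_clebsch], of id])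
      (simp add: graph_hom_def)
  have Gr: "groetzsch \<approx>\<^sub>c\<^sub>c cycle_graph 5"
    using simple(3) graph_hom_groetzsch_clebsch graph_hom_C5_groetzsch by (rule C5)
  have D: "dodecahedron \<approx>\<^sub>c\<^sub>c cycle_graph 5"
    using simple(4) graph_hom_comp[OF graph_hom_dodecahedron_petersen graph_hom_petersen_clebsch]
      graph_hom_C5_dodecahedron by (rule C5)
  have tf_C5: "triangle_free (cycle_graph 5)"
    using C5_P triangle_free_petersen by (rule triangle_free_hom)
  have tf_Gr: "triangle_free groetzsch"
    using tf_C5 unfolding groetzsch_def by (rule triangle_free_mycielskian)
  have fin: "finite (verts petersen)" "finite (verts groetzsch)" "finite (verts (cycle_graph 5))"
    using simple by (auto simp: simple_graph_def)
  \<comment> \<open>The counting obstructions: 10 vertices against 5, at least 16 against 10, 11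
    against 10, and at least 16 against 11.\<close>
  have P_C5: "\<nexists>\<phi>. graph_hom petersen (cycle_graph 5) \<phi>"
    using no_graph_hom_card[OF all_joined3_petersen tf_C5 fin(3)]
    by (simp add: card_petersen verts_C5)
  have Cl_P: "\<nexists>\<phi>. graph_hom clebsch petersen \<phi>"
    using no_graph_hom_card[OF all_joined3_clebsch triangle_free_petersen fin(1)] card_clebsch
    by (simp add: card_petersen)
  have Gr_P: "\<nexists>\<phi>. graph_hom groetzsch petersen \<phi>"
    using no_graph_hom_card[OF all_joined3_groetzsch triangle_free_petersen fin(1)]
    by (simp add: card_petersen card_groetzsch)
  have Cl_Gr: "\<nexists>\<phi>. graph_hom clebsch groetzsch \<phi>"
    using no_graph_hom_card[OF all_joined3_clebsch tf_Gr fin(2)] card_clebsch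
    by (simp add: card_groetzsch)
  \<comment> \<open>The dodecahedron and the 5-circuit map to the Petersen graph, so an obstruction
    to reaching the latter is one to reaching them.\<close>
  have via_P: "\<nexists>\<phi>. graph_hom G dodecahedron \<phi>" "\<nexists>\<phi>. graph_hom G (cycle_graph 5) \<phi>"
    if "\<nexists>\<phi>. graph_hom G petersen \<phi>" for G :: "'v ugraph"
    using that graph_hom_comp graph_hom_dodecahedron_petersen C5_P by blast+
  have "petersen \<approx>\<^sub>c\<^sub>c clebsch \<and> clebsch \<approx>\<^sub>c\<^sub>c groetzsch \<and>
      groetzsch \<approx>\<^sub>c\<^sub>c dodecahedron \<and> dodecahedron \<approx>\<^sub>c\<^sub>c cycle_graph 5"
    using P Cl Gr D by (blast intro: cc_equiv_trans cc_equiv_sym)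
  then show ?thesis
    using P_C5 Cl_P Gr_P Cl_Gr via_P[OF Cl_P] via_P[OF Gr_P]
      no_hom_petersen_dodecahedron no_hom_dodecahedron_C5
    unfolding hom_equiv_def by blast
qed

end
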